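(* The two-sided left overlap division $\mathcal W$ on the monomials of $R\langle x_1,\dots,x_n\rangle$ is continuous.
   Context: Monomials are words in the noncommuting variables $x_1,\dots,x_n$. An involutive division is a rule $I$ assigning to every finite set $U$ of monomials and every $u\in U$ a set $\mathcal M^L_I(u,U)\subseteq\{x_1,\dots,x_n\}$ of left multiplicative variables and a set $\mathcal M^R_I(u,U)\subseteq\{x_1,\dots,x_n\}$ of right multiplicative variables. For $u\in U$ and a factorisation $w=v_1uv_2$, $u$ is an involutive divisor of $w$ at this factorisation if (thin divisors) the last letter of $v_1$ (if $v_1\ne1$) is in $\mathcal M^L_I(u,U)$ and the first letter of $v_2$ (if $v_2\neq1$) is in $\mathcal M^R_I(u,U)$. DegRevLex ordering (with $x_1>x_2>\cdots>x_n$): $m_1<m_2$ if $\deg m_1<\deg m_2$, or the degrees are equal and, reading from right to left, at the first position where the words differ the letter of $m_1$ is greater than that of $m_2$. Two-sided left overlap division $\mathcal W$. Let $U=\{u_1,\dots,u_m\}$ be a finite set of monomials listed so that $u_1>u_2>\cdots>u_m$ in DegRevLex. Start with all variables left and right multiplicative for all $u_i$. For $i=1,\dots,m$ and, for each $i$, for $j=i,i+1,\dots,m$, with $u_i=x_{i_1}\cdots x_{i_\alpha}$ and $u_j=x_{j_1}\cdots x_{j_\beta}$, do: (1) if $i\ne j$, then for each $1\le k\le\alpha-\beta+1$ with $x_{i_k}\cdots x_{i_{k+\beta-1}}=u_j$: if $k<\alpha-\beta+1$ make $x_{i_{k+\beta}}$ right nonmultiplicative for $u_j$, and if $k=\alpha-\beta+1$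 make $x_{i_{k-1}}$ left nonmultiplicative for $u_j$; (2) for $k=1,\dots,\beta-1$ in order: if the prefix of $u_i$ of length $k$ equals the suffix of $u_j$ of length $k$, and currently $x_{j_{\beta-k}}$ is left multiplicative for $u_i$ and $x_{i_{k+1}}$ is right multiplicative for $u_j$, make $x_{i_{k+1}}$ right nonmultiplicative for $u_j$; then, if the suffix of $u_i$ of length $k$ equals the prefix of $u_j$ of length $k$, and currently $x_{j_{k+1}}$ is right multiplicative for $u_i$ and $x_{i_{\alpha-k}}$ is left multiplicative for $u_j$, make $x_{i_{\alpha-k}}$ left nonmultiplicative for $u_j$. Continuity. Let $w$ be a monomial, $U$ a finite set of monomials, and $(u_1,\dots,u_k)$ a sequence in $U$ with factorisations $w=\ell_iu_ir_i$. Suppose for each $1\le i<k$ exactly one of the following holds: (a) $\ell_i\neq1$, its last letter $x$ is not in $\mathcal M^L_I(u_i,U)$, and $u_{i+1}$ involutively divides $xu_i$; (b) $r_i\ne1$, its first letter $x$ is not in $\mathcal M^R_I(u_i,U)$, and $u_{i+1}$ involutively divides $u_ix$; where the occurrence of $u_{i+1}$ in $w$ given by $(\ell_{i+1},r_{i+1})$ is the one induced by its occurrence (as involutive divisor) in the prolongation $xu_i$, resp. $u_ix$, located in $w$. $I$ is continuous if for all such data the pairs $(\ell_i,r_i)$ are pairwise distinct. *)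

theory Defs
  imports Main
begin

text \<open>
  The variable x_i is represented by its index i, so a monomial in x_1, ..., x_n is a list
  over {1..n}, and the ordering x_1 > x_2 > ... > x_n of the variables is the reverse of the
  ordering of the indices.
\<close>

type_synonym monomial = "nat list"

definition monomials :: "nat \<Rightarrow> monomial set" where
  "monomials n = {w. set w \<subseteq> {1..n}}"

text \<open>
  The first differing letters, read from right to left, are \<open>rev m1 ! p\<close> and \<open>rev m2 ! p\<close>.
  The letter of \<open>m1\<close> is the greater variable iff its index is the smaller one.
\<close>

definition degrevlex_less :: "monomial \<Rightarrow> monomial \<Rightarrow> bool" where
  "degrevlex_less m1 m2 \<longleftrightarrow>
     length m1 < length m2 \<or>
     (length m1 = length m2 \<and>
      (\<exists>p < length m1. (\<forall>q < p. rev m1 ! q = rev m2 ! q) \<and> rev m1 ! p < rev m2 ! p))"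


section \<open>Involutive divisions and continuity\<close>

text \<open>\<open>I U u\<close> is the pair of the sets of left and of right multiplicative variables of \<open>u\<close>
  with respect to \<open>U\<close>; only its values for finite \<open>U\<close> and \<open>u \<in> U\<close> are relevant.\<close>

type_synonym division = "monomial set \<Rightarrow> monomial \<Rightarrow> nat set \<times> nat set"

definition left_mult :: "division \<Rightarrow> monomial \<Rightarrow> monomial set \<Rightarrow> nat set" where
  "left_mult I u U = fst (I U u)"

definition right_mult :: "division \<Rightarrow> monomial \<Rightarrow> monomial set \<Rightarrow> nat set" where
  "right_mult I u U = snd (I U u)"

definition involutive_divisor_at ::
  "division \<Rightarrow> monomial set \<Rightarrow> monomial \<Rightarrow> monomial \<Rightarrow> monomial \<Rightarrow> monomial \<Rightarrow> bool" where
  "involutive_divisor_at I U u w v1 v2 \<longleftrightarrow>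
     u \<in> U \<and> w = v1 @ u @ v2 \<and>
     (v1 \<noteq> [] \<longrightarrow> last v1 \<in> left_mult I u U) \<and>
     (v2 \<noteq> [] \<longrightarrow> hd v2 \<in> right_mult I u U)"

text \<open>
  The following two predicates relate an occurrence \<open>l @ u @ r\<close> of \<open>u\<close> in a monomial to an
  occurrence \<open>l' @ u' @ r'\<close> of \<open>u'\<close> in the same monomial, where the latter is the one induced
  by an occurrence of \<open>u'\<close> as involutive divisor in the prolongation \<open>x # u\<close>, resp. \<open>u @ [x]\<close>.
\<close>

definition left_prolongation_step ::
  "division \<Rightarrow> monomial set \<Rightarrow> monomial \<Rightarrow> monomial \<Rightarrow> monomial \<Rightarrow>
     monomial \<Rightarrow> monomial \<Rightarrow> monomial \<Rightarrow> bool" where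
  "left_prolongation_step I U l u r l' u' r' \<longleftrightarrow>
     l \<noteq> [] \<and> last l \<notin> left_mult I u U \<and>
     (\<exists>v1 v2. involutive_divisor_at I U u' (last l # u) v1 v2 \<and>
              l' = butlast l @ v1 \<and> r' = v2 @ r)"

definition right_prolongation_step ::
  "division \<Rightarrow> monomial set \<Rightarrow> monomial \<Rightarrow> monomial \<Rightarrow> monomial \<Rightarrow>
     monomial \<Rightarrow> monomial \<Rightarrow> monomial \<Rightarrow> bool" where
  "right_prolongation_step I U l u r l' u' r' \<longleftrightarrow>
     r \<noteq> [] \<and> hd r \<notin> right_mult I u U \<and>
     (\<exists>v1 v2. involutive_divisor_at I U u' (u @ [hd r]) v1 v2 \<and>
              l' = l @ v1 \<and> r' = v2 @ tl r)"

text \<open>The inequality of truth values expresses that exactly one of the two steps holds.\<close>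

definition continuous_division :: "nat \<Rightarrow> division \<Rightarrow> bool" where
  "continuous_division n I \<longleftrightarrow>
     (\<forall>w U k u l r.
        w \<in> monomials n \<and> finite U \<and> U \<subseteq> monomials n \<and>
        (\<forall>i\<in>{1..k::nat}. u i \<in> U \<and> w = l i @ u i @ r i) \<and>
        (\<forall>i\<in>{1..<k}.
           left_prolongation_step I U (l i) (u i) (r i) (l (i + 1)) (u (i + 1)) (r (i + 1)) \<noteq>
           right_prolongation_step I U (l i) (u i) (r i) (l (i + 1)) (u (i + 1)) (r (i + 1)))
        \<longrightarrow> (\<forall>i\<in>{1..k}. \<forall>j\<in>{1..k}. i \<noteq> j \<longrightarrow> (l i, r i) \<noteq> (l j, r j)))"


section \<open>The two-sided left overlap division\<close>

text \<open>A state consists of the currently left and the currently right multiplicative variables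
  of every monomial.\<close>

type_synonym state = "(monomial \<Rightarrow> nat set) \<times> (monomial \<Rightarrow> nat set)"

definition make_left_nonmult :: "nat \<Rightarrow> monomial \<Rightarrow> state \<Rightarrow> state" where
  "make_left_nonmult x u s = ((fst s)(u := fst s u - {x}), snd s)"

definition make_right_nonmult :: "nat \<Rightarrow> monomial \<Rightarrow> state \<Rightarrow> state" where
  "make_right_nonmult x u s = (fst s, (snd s)(u := snd s u - {x}))"

text \<open>Positions in monomials are counted from 1.\<close>

definition letter :: "monomial \<Rightarrow> nat \<Rightarrow> nat" where
  "letter u p = u ! (p - 1)"

text \<open>
  In the following \<open>a\<close> and \<open>b\<close> are the monomials u_i and u_j with \<open>i \<le> j\<close>, so
  \<open>length b \<le> length a\<close> and the subtractions of lengths are not truncated.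
\<close>

definition subword_step :: "monomial \<Rightarrow> monomial \<Rightarrow> nat \<Rightarrow> state \<Rightarrow> state" where
  "subword_step a b k s =
     (if take (length b) (drop (k - 1) a) = b
      then if k < length a - length b + 1
           then make_right_nonmult (letter a (k + length b)) b s
           else make_left_nonmult (letter a (k - 1)) b s
      else s)"

definition overlap_step_right :: "monomial \<Rightarrow> monomial \<Rightarrow> nat \<Rightarrow> state \<Rightarrow> state" where
  "overlap_step_right a b k s =
     (if take k a = drop (length b - k) b \<and>
         letter b (length b - k) \<in> fst s a \<and> letter a (k + 1) \<in> snd s b
      then make_right_nonmult (letter a (k + 1)) b s
      else s)"

definition overlap_step_left :: "monomial \<Rightarrow> monomial \<Rightarrow> nat \<Rightarrow> state \<Rightarrow> state" where
  "overlap_step_left a b k s =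
     (if drop (length a - k) a = take k b \<and>
         letter b (k + 1) \<in> snd s a \<and> letter a (length a - k) \<in> fst s b
      then make_left_nonmult (letter a (length a - k)) b s
      else s)"

definition process_pair :: "monomial \<Rightarrow> monomial \<Rightarrow> state \<Rightarrow> state" where
  "process_pair a b s =
     fold (\<lambda>k s. overlap_step_left a b k (overlap_step_right a b k s)) [1..<length b]
       (if a \<noteq> b then fold (subword_step a b) [1..<length a - length b + 2] s else s)"

definition process_all :: "monomial list \<Rightarrow> state \<Rightarrow> state" where
  "process_all us =
     fold (\<lambda>i. fold (\<lambda>j. process_pair (us ! i) (us ! j)) [i..<length us]) [0..<length us]"

definition descending_listing :: "monomial set \<Rightarrow> monomial list" where
  "descending_listing U =
     (THE us. set us = U \<and> sorted_wrt (\<lambda>u v. degrevlex_less v u) us)"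

lemma degrevlex_less_trans:
  "degrevlex_less a b \<Longrightarrow> degrevlex_less b c \<Longrightarrow> degrevlex_less a c"
  unfolding degrevlex_less_def by (smt (verit) linorder_neqE_nat order.strict_trans)

lemma degrevlex_less_irrefl: "\<not> degrevlex_less a a" unfolding degrevlex_less_def by auto

lemma degrevlex_less_total:
  assumes "a \<noteq> b" shows "degrevlex_less a b \<or> degrevlex_less b a"
proof (cases "length a = length b")
  case True
  hence ex: "\<exists>p. p < length a \<and> rev a ! p \<noteq> rev b ! p" using assms
    by (metis length_rev nth_equalityI rev_rev_ident)
  define p where "p = (LEAST p. p < length a \<and> rev a ! p \<noteq> rev b ! p)"
  have p: "p < length a" "rev a ! p \<noteq> rev b ! p" using LeastI_ex[OF ex] p_def by auto
  have "\<forall>q<p. rev a ! q = rev b ! q" using not_less_Least p(1) p_def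
    by (metis (mono_tags, lifting) order.strict_trans)
  thus ?thesis using p True unfolding degrevlex_less_def by (metis linorder_neqE_nat)
qed (auto simp: degrevlex_less_def)

lemma descending_listing_unique:
  "finite U \<Longrightarrow> \<exists>!us. set us = U \<and> sorted_wrt (\<lambda>u v. degrevlex_less v u) us"
proof -
  assume f: "finite U"
  interpret L: linorder "\<lambda>u v. u = v \<or> degrevlex_less v u" "\<lambda>u v. degrevlex_less v u"
    by unfold_locales (use degrevlex_less_trans degrevlex_less_irrefl degrevlex_less_total in blast)+
  show ?thesis
    by (metis f L.finite_set_strict_sorted L.strict_sorted_equal)
qed

definition left_overlap_division :: "nat \<Rightarrow> division" where
  "left_overlap_division n U u =
     (let s = process_all (descending_listing U) (\<lambda>_. {1..n}, \<lambda>_. {1..n})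
      in (fst s u, snd s u))"

end

theory Submission
  imports Defs
begin

text \<open>
  By the subword rule, a right prolongation step moves the right end of the occurrence by exactly
  one letter to the right, and a left prolongation step moves its left end by exactly one letter
  to the left. If a left step also moves the right end, then the letter following the new
  occurrence is right multiplicative for it. This property survives all later steps: it forbids
  right steps, and it passes from \<open>u\<close> to \<open>x # u\<close>, because anything that makes a letter right
  nonmultiplicative for a monomial does the same for all of its suffixes in \<open>U\<close>. So if it holds
  somewhere on a cycle, then it holds on all of it, and all steps go left; otherwise
  (length of \<open>r\<close>, length of \<open>l\<close>) decreases lexicographically along the cycle.
\<close>

section \<open>Monotonicity and locality of state changes\<close>

definition shrinks :: "state \<Rightarrow> state \<Rightarrow> bool" where
  "shrinks s s' \<longleftrightarrow> (\<forall>u. fst s' u \<subseteq> fst s u \<and> snd s' u \<subseteq> snd s u)"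

text \<open>Comparing \<open>a\<close> with \<open>b\<close> alters the data of \<open>b\<close>
  alone; this relation carries all other data unchanged through the loops.\<close>

definition agree_at :: "monomial \<Rightarrow> state \<Rightarrow> state \<Rightarrow> bool" where
  "agree_at u s s' \<longleftrightarrow> fst s' u = fst s u \<and> snd s' u = snd s u"

lemma shrinks_refl: "shrinks s s"
  by (simp add: shrinks_def)

lemma shrinks_trans: "shrinks s t \<Longrightarrow> shrinks t r \<Longrightarrow> shrinks s r"
  unfolding shrinks_def by blast

lemma agree_at_refl: "agree_at u s s"
  by (simp add: agree_at_def)

lemma agree_at_trans: "agree_at u s t \<Longrightarrow> agree_at u t r \<Longrightarrow> agree_at u s r"
  unfolding agree_at_def by simp

lemma fold_shrinks:
  assumes "\<And>x s. x \<in> set xs \<Longrightarrow> shrinks s (f x s)"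
  shows "shrinks s (fold f xs s)"
  using assms
proof (induction xs arbitrary: s)
  case (Cons x xs)
  then have "shrinks s (f x s)" "shrinks (f x s) (fold f xs (f x s))" by simp_all
  then show ?case using shrinks_trans by simp
qed (simp add: shrinks_refl)

lemma fold_agree_at:
  assumes "\<And>x s. x \<in> set xs \<Longrightarrow> agree_at u s (f x s)"
  shows "agree_at u s (fold f xs s)"
  using assms
proof (induction xs arbitrary: s)
  case (Cons x xs)
  then have "agree_at u s (f x s)" "agree_at u (f x s) (fold f xs (f x s))" by simp_all
  then show ?case using agree_at_trans by simp
qed (simp add: agree_at_refl)

lemma fold_invariant_fst:
  assumes "\<And>x s. x \<in> set xs \<Longrightarrow> fst (f x s) u = fst s u"
  shows "fst (fold f xs s) u = fst s u"
  using assms by (induction xs arbitrary: s) auto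

text \<open>Isolates the step that destroys \<open>P\<close>, so that the guard of this step reveals
  the cause.\<close>

lemma fold_first_change:
  assumes "P s" and "\<not> P (fold f xs s)"
  obtains ys x zs where "xs = ys @ x # zs" "P (fold f ys s)" "\<not> P (f x (fold f ys s))"
  using assms
proof (induction xs arbitrary: s thesis)
  case Nil
  then show ?case by simp
next
  case (Cons x xs)
  show ?case
  proof (cases "P (f x s)")
    case True
    obtain ys y zs where "xs = ys @ y # zs" "P (fold f ys (f x s))"
        "\<not> P (f y (fold f ys (f x s)))"
      using Cons.IH[OF _ True] Cons.prems(3) by auto
    then show ?thesis using Cons.prems(1)[of "x # ys" y zs] by simp
  next
    case False
    then show ?thesis using Cons.prems(1)[of "[]" x xs] Cons.prems(2) by simp
  qed
qed

lemma upt_split: "i \<le> k \<Longrightarrow> k < j \<Longrightarrow> [i..<j] = [i..<k] @ k # [Suc k..<j]"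
  by (metis le_add_diff_inverse less_imp_le upt_add_eq_append upt_conv_Cons)

section \<open>Comparison of one pair of monomials\<close>

abbreviation overlap_step :: "monomial \<Rightarrow> monomial \<Rightarrow> nat \<Rightarrow> state \<Rightarrow> state" where
  "overlap_step a b k s \<equiv> overlap_step_left a b k (overlap_step_right a b k s)"

lemmas step_defs = subword_step_def overlap_step_right_def overlap_step_left_def
  make_left_nonmult_def make_right_nonmult_def

lemma shrinks_steps:
  "shrinks s (subword_step a b k s)"
  "shrinks s (overlap_step a b k s)"
  by (auto simp: shrinks_def step_defs)

lemma agree_at_steps:
  assumes "c \<noteq> b"
  shows "agree_at c s (subword_step a b k s)" "agree_at c s (overlap_step a b k s)"
  using assms by (auto simp: agree_at_def step_defs)

definition subword_phase :: "monomial \<Rightarrow> monomial \<Rightarrow> state \<Rightarrow> state" where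
  "subword_phase a b s =
     (if a \<noteq> b then fold (subword_step a b) [1..<length a - length b + 2] s else s)"

lemma process_pair_eq:
  "process_pair a b s = fold (overlap_step a b) [1..<length b] (subword_phase a b s)"
  by (simp add: process_pair_def subword_phase_def)

lemma shrinks_subword_phase: "shrinks s (subword_phase a b s)"
  unfolding subword_phase_def by (simp add: shrinks_refl fold_shrinks shrinks_steps del: upt_Suc)

lemma shrinks_process_pair: "shrinks s (process_pair a b s)"
  unfolding process_pair_eq
  by (rule shrinks_trans[OF shrinks_subword_phase fold_shrinks]) (rule shrinks_steps)

lemma agree_at_subword_phase: "c \<noteq> b \<Longrightarrow> agree_at c s (subword_phase a b s)"
  unfolding subword_phase_def by (simp add: agree_at_refl fold_agree_at agree_at_steps del: upt_Suc)

lemma agree_at_process_pair: "c \<noteq> b \<Longrightarrow> agree_at c s (process_pair a b s)"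
  unfolding process_pair_eq
  by (rule agree_at_trans[OF agree_at_subword_phase fold_agree_at]) (auto intro: agree_at_steps)

text \<open>For a self-overlap both halves of a step test the same condition, and the first half
  makes it false, so the second half does nothing.\<close>

lemma process_pair_self_left: "fst (process_pair a a s) a = fst s a"
  unfolding process_pair_eq subword_phase_def
  by (simp, rule fold_invariant_fst) (auto simp: step_defs)

text \<open>Rule (1) meets this occurrence at \<open>k = length v + 1\<close> and removes the letter
  there; no later step restores it.\<close>

lemma process_pair_subword:
  assumes "a = v @ b @ r" "a \<noteq> b"
  shows "r \<noteq> [] \<Longrightarrow> hd r \<notin> snd (process_pair a b s) b"
    and "r = [] \<Longrightarrow> last v \<notin> fst (process_pair a b s) b"
proof -
  let ?k = "length v + 1"
  have len: "length a - length b + 1 = length v + length r + 1" using assms by simp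
  have upt: "[1..<length a - length b + 2] = [1..<?k] @ ?k # [Suc ?k..<length a - length b + 2]"
    by (rule upt_split) (use len in simp_all)
  define s1 where "s1 = fold (subword_step a b) [1..<?k] s"
  have sub: "subword_phase a b s
      = fold (subword_step a b) [Suc ?k..<length a - length b + 2] (subword_step a b ?k s1)"
    unfolding subword_phase_def upt s1_def using assms(2) by simp
  have sh: "shrinks (subword_step a b ?k s1) (process_pair a b s)"
    unfolding process_pair_eq sub
    by (rule shrinks_trans[OF fold_shrinks fold_shrinks]) (rule shrinks_steps)+
  have match: "take (length b) (drop (?k - 1) a) = b" using assms by simp
  show "hd r \<notin> snd (process_pair a b s) b" if "r \<noteq> []"
  proof -
    have "letter a (?k + length b) = hd r" using that assms(1)
      by (simp add: letter_def nth_append hd_conv_nth)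
    moreover have "?k < length a - length b + 1" using len that by simp
    ultimately have "hd r \<notin> snd (subword_step a b ?k s1) b"
      using match by (simp add: subword_step_def make_right_nonmult_def)
    then show ?thesis using sh by (auto simp: shrinks_def)
  qed
  show "last v \<notin> fst (process_pair a b s) b" if "r = []"
  proof -
    \<comment> \<open>For \<open>v = []\<close> the position would be 0, where \<open>letter\<close>
      falls back to the first letter of \<open>a\<close>.\<close>
    have "v \<noteq> []" using assms that by auto
    then have "letter a (?k - 1) = last v" using assms(1)
      by (simp add: letter_def nth_append last_conv_nth)
    moreover have "\<not> ?k < length a - length b + 1" using len that by simp
    ultimately have "last v \<notin> fst (subword_step a b ?k s1) b"
      using match by (simp add: subword_step_def make_left_nonmult_def)
    then show ?thesis using sh by (auto simp: shrinks_def)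
  qed
qed

text \<open>Rule (2) sees the overlap at \<open>k = length p\<close>. By then \<open>y\<close> is
  still left multiplicative for \<open>a\<close>, since only data of \<open>b\<close> have
  changed.\<close>

lemma process_pair_overlap:
  assumes ab: "a = p @ x # q" "b = o' @ y # p" "p \<noteq> []" "a \<noteq> b" and y: "y \<in> fst s a"
  shows "x \<notin> snd (process_pair a b s) b"
proof -
  let ?k = "length p"
  have upt: "[1..<length b] = [1..<?k] @ ?k # [Suc ?k..<length b]"
    by (rule upt_split) (use ab(2,3) in \<open>simp_all add: Suc_le_eq\<close>)
  define s1 where "s1 = fold (overlap_step a b) [1..<?k] (subword_phase a b s)"
  have pp: "process_pair a b s
      = fold (overlap_step a b) [Suc ?k..<length b] (overlap_step a b ?k s1)"
    unfolding process_pair_eq upt s1_def by simp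
  have "agree_at a s s1" unfolding s1_def
    by (rule agree_at_trans[OF agree_at_subword_phase fold_agree_at])
      (use ab in \<open>auto intro: agree_at_steps\<close>)
  then have y1: "y \<in> fst s1 a" using y by (simp add: agree_at_def)
  have "letter b (length b - ?k) = y" "letter a (?k + 1) = x"
    using ab by (simp_all add: letter_def nth_append)
  \<comment> \<open>If the guard fails, it does so because \<open>x\<close> has already been
    removed.\<close>
  then have "x \<notin> snd (overlap_step a b ?k s1) b" using y1 ab(1,2)
    by (auto simp: step_defs)
  moreover have "shrinks (overlap_step a b ?k s1) (process_pair a b s)"
    unfolding pp by (rule fold_shrinks) (rule shrinks_steps)
  ultimately show ?thesis by (auto simp: shrinks_def)
qed

text \<open>Here \<open>L\<close> stands for the left multiplicative variables of \<open>a\<close>, which are already final when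
  the algorithm compares \<open>a\<close> with later monomials \<open>b\<close>.\<close>

definition right_blocked :: "monomial \<Rightarrow> nat set \<Rightarrow> monomial \<Rightarrow> nat \<Rightarrow> bool" where
  "right_blocked a L b x \<longleftrightarrow>
     (\<exists>v q. a = v @ b @ x # q) \<or>
     (\<exists>p q o' y. a = p @ x # q \<and> b = o' @ y # p \<and> p \<noteq> [] \<and> y \<in> L)"

text \<open>Converse to the two preceding lemmas for right variables: the guard of the first step
  that removes \<open>x\<close> exhibits either a subword or an overlap.\<close>

lemma process_pair_right_blocked:
  assumes "length b \<le> length a" "x \<in> snd s b" "x \<notin> snd (process_pair a b s) b"
  shows "right_blocked a (fst s a) b x"
proof (cases "x \<in> snd (subword_phase a b s) b")
  case True
  from assms(3) obtain ks k ks' where ks: "[1..<length b] = ks @ k # ks'"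
    and x1: "x \<in> snd (fold (overlap_step a b) ks (subword_phase a b s)) b"
    and x2: "x \<notin> snd (overlap_step a b k (fold (overlap_step a b) ks (subword_phase a b s))) b"
    unfolding process_pair_eq
    using fold_first_change[where P = "\<lambda>s. x \<in> snd s b", OF True] by blast
  define s1 where "s1 = fold (overlap_step a b) ks (subword_phase a b s)"
  have "k \<in> set [1..<length b]" unfolding ks by simp
  then have k: "1 \<le> k" "k < length b" by simp_all
  have sh: "shrinks s s1" unfolding s1_def
    by (rule shrinks_trans[OF shrinks_subword_phase fold_shrinks]) (rule shrinks_steps)
  have "take k a = drop (length b - k) b \<and> letter b (length b - k) \<in> fst s1 a
      \<and> letter a (k + 1) = x"
    using x1 x2 unfolding s1_def[symmetric] by (auto simp: step_defs split: if_splits)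
  \<comment> \<open>The guard was tested in \<open>s1\<close>; as the sets only shrink, its left
    condition held in \<open>s\<close> too.\<close>
  then have t: "take k a = drop (length b - k) b" and y: "letter b (length b - k) \<in> fst s a"
    and x: "a ! k = x"
    using sh by (auto simp: shrinks_def letter_def)
  have "a = take k a @ x # drop (Suc k) a"
    using x k assms(1) by (metis id_take_nth_drop order.strict_trans2)
  moreover have "b = take (length b - k - 1) b @ letter b (length b - k) # take k a"
    unfolding t letter_def using id_take_nth_drop[of "length b - k - 1" b] k
    by (simp add: Suc_diff_Suc)
  moreover have "take k a \<noteq> []" using k assms(1) by auto
  ultimately show ?thesis using y unfolding right_blocked_def by blast
next
  case False
  then have ne: "a \<noteq> b" using assms(2) by (auto simp: subword_phase_def)
  with False have False': "x \<notin> snd (fold (subword_step a b) [1..<length a - length b + 2] s) b"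
    by (simp add: subword_phase_def)
  obtain ks k ks' where ks: "[1..<length a - length b + 2] = ks @ k # ks'"
    and x1: "x \<in> snd (fold (subword_step a b) ks s) b"
    and x2: "x \<notin> snd (subword_step a b k (fold (subword_step a b) ks s)) b"
    using fold_first_change[where P = "\<lambda>s. x \<in> snd s b", OF assms(2) False'] by blast
  have "k \<in> set [1..<length a - length b + 2]" unfolding ks by simp
  then have k: "1 \<le> k" by (simp del: upt_Suc)
  \<comment> \<open>Only the first branch touches right variables, so \<open>k\<close> is not the
    last position and a letter follows the occurrence.\<close>
  have *: "take (length b) (drop (k - 1) a) = b" "k < length a - length b + 1"
      "letter a (k + length b) = x"
    using x1 x2 by (auto simp: step_defs split: if_splits)
  have "drop (k - 1) a = b @ drop (k - 1 + length b) a"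
    using append_take_drop_id[of "length b" "drop (k - 1) a"] *(1) by (simp add: add.commute)
  moreover from *(2,3) k have "drop (k - 1 + length b) a = x # drop (Suc (k - 1 + length b)) a"
    using Cons_nth_drop_Suc[of "k - 1 + length b" a] by (simp add: letter_def)
  ultimately have "a = take (k - 1) a @ b @ x # drop (Suc (k - 1 + length b)) a"
    by (metis append_take_drop_id)
  then show ?thesis unfolding right_blocked_def by blast
qed

section \<open>The complete run of the algorithm\<close>

fun process_list :: "monomial list \<Rightarrow> state \<Rightarrow> state" where
  "process_list [] s = s"
| "process_list (a # us) s = process_list us (fold (process_pair a) (a # us) s)"

text \<open>Trades the index loops for a recursion on tails, which permits induction on the
  listing.\<close>

lemma process_all_eq: "process_all us s = process_list us s"
proof -
  have inner: "fold (\<lambda>j. f (us ! j)) [i..<length us] = fold f (drop i us)"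
    for f :: "monomial \<Rightarrow> state \<Rightarrow> state" and i and us :: "monomial list"
  proof -
    have "map ((!) us) [i..<length us] = drop i us"
      by (rule nth_equalityI) auto
    moreover have "fold (\<lambda>j. f (us ! j)) [i..<length us] = fold f (map ((!) us) [i..<length us])"
      unfolding fold_map comp_def ..
    ultimately show ?thesis by simp
  qed
  have "fold (\<lambda>i. fold (process_pair (us ! i)) (drop i us)) [0..<length us] s = process_list us s"
  proof (induction us arbitrary: s)
    case (Cons a us)
    \<comment> \<open>Shifting the outer index by one turns \<open>drop (Suc i) (a # us)\<close>
      into \<open>drop i us\<close>.\<close>
    have "[0..<length (a # us)] = 0 # map Suc [0..<length us]"
      by (simp add: upt_conv_Cons map_Suc_upt del: upt_Suc)
    then show ?case using Cons by (simp add: fold_map comp_def del: upt_Suc)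
  qed simp
  then show ?thesis unfolding process_all_def inner .
qed

lemma shrinks_process_list: "shrinks s (process_list us s)"
proof (induction us arbitrary: s)
  case (Cons a us)
  have "shrinks s (fold (process_pair a) (a # us) s)"
    by (rule fold_shrinks) (rule shrinks_process_pair)
  then show ?case using Cons shrinks_trans by fastforce
qed (simp add: shrinks_refl)

lemma agree_at_process_list: "c \<notin> set us \<Longrightarrow> agree_at c s (process_list us s)"
proof (induction us arbitrary: s)
  case (Cons a us)
  then have "agree_at c s (fold (process_pair a) (a # us) s)"
    by (intro fold_agree_at agree_at_process_pair) auto
  then show ?case using Cons agree_at_trans by fastforce
qed (simp add: agree_at_refl)

lemma fold_process_pair_left: "fst (fold (process_pair a) bs s) a = fst s a"
  by (rule fold_invariant_fst)
    (metis agree_at_def agree_at_process_pair process_pair_self_left)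

text \<open>The self-comparison spares the left variables of \<open>a\<close>, and all other
  comparisons from here on change other monomials.\<close>

lemma process_list_head_left:
  "a \<notin> set us \<Longrightarrow> fst (process_list (a # us) s) a = fst s a"
  using agree_at_process_list[of a us "fold (process_pair a) (a # us) s"]
    fold_process_pair_left[of a "a # us" s]
  by (simp add: agree_at_def)

text \<open>Take for \<open>s1\<close> the state just before \<open>a\<close> meets
  \<open>b\<close>: in a distinct list this is the only comparison that changes
  \<open>b\<close>.\<close>

lemma fold_process_pair_at:
  assumes "distinct bs" "b \<in> set bs"
  obtains s1 where "agree_at b s s1" "fst s1 a = fst s a"
    "agree_at b (process_pair a b s1) (fold (process_pair a) bs s)"
proof -
  obtain ys zs where bs: "bs = ys @ b # zs" using assms(2) split_list by metis
  have "agree_at b s (fold (process_pair a) ys s)"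
    by (intro fold_agree_at agree_at_process_pair) (use assms(1) bs in auto)
  moreover have "agree_at b (process_pair a b (fold (process_pair a) ys s))
      (fold (process_pair a) zs (process_pair a b (fold (process_pair a) ys s)))"
    by (intro fold_agree_at agree_at_process_pair) (use assms(1) bs in auto)
  ultimately show ?thesis using that fold_process_pair_left bs by simp
qed

abbreviation descending :: "monomial list \<Rightarrow> bool" where
  "descending \<equiv> sorted_wrt (\<lambda>u v. degrevlex_less v u)"

lemma descending_distinct: "descending us \<Longrightarrow> distinct us"
  by (induction us) (auto simp: degrevlex_less_irrefl)

lemma degrevlex_less_length: "degrevlex_less b a \<Longrightarrow> length b \<le> length a"
  by (auto simp: degrevlex_less_def)

text \<open>Here \<open>s1\<close> is the state in which \<open>a\<close> is compared with
  \<open>b\<close>. The left variables of \<open>a\<close> are final by then, whereas those of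
  \<open>b\<close> may still shrink, hence the inclusions.\<close>

lemma process_list_pair:
  assumes "descending us" "a \<in> set us" "b \<in> set us" "degrevlex_less b a"
  obtains s1 where "fst s1 a = fst (process_list us s) a"
    "fst (process_list us s) b \<subseteq> fst (process_pair a b s1) b"
    "snd (process_list us s) b \<subseteq> snd (process_pair a b s1) b"
  using assms
proof (induction us arbitrary: s thesis)
  case Nil
  then show ?case by simp
next
  case (Cons c us)
  note d = descending_distinct[OF Cons.prems(2)]
  let ?s = "fold (process_pair c) (c # us) s"
  show ?case
  proof (cases "a = c")
    case True
    obtain s1 where s1: "fst s1 a = fst s a"
        "agree_at b (process_pair a b s1) (fold (process_pair a) (c # us) s)"
      using fold_process_pair_at[OF d Cons.prems(4)] by metis
    have "fst s1 a = fst (process_list (c # us) s) a"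
      using s1(1) process_list_head_left[of c us s] d True by simp
    moreover have "fst (process_list us ?s) b \<subseteq> fst ?s b" "snd (process_list us ?s) b \<subseteq> snd ?s b"
      using shrinks_process_list[of ?s us] unfolding shrinks_def by blast+
    ultimately show ?thesis
      using Cons.prems(1)[of s1] s1(2) True by (simp add: agree_at_def)
  next
    case False
    \<comment> \<open>The head \<open>c\<close> exceeds \<open>a\<close>, which exceeds
      \<open>b\<close>, so \<open>b\<close> is not the head either.\<close>
    with Cons.prems have "a \<in> set us" "b \<in> set us"
      by (auto dest: degrevlex_less_trans simp: degrevlex_less_irrefl)
    moreover have "descending us" using Cons.prems(2) by simp
    ultimately obtain s1 where "fst s1 a = fst (process_list us ?s) a"
      "fst (process_list us ?s) b \<subseteq> fst (process_pair a b s1) b"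
      "snd (process_list us ?s) b \<subseteq> snd (process_pair a b s1) b"
      using Cons.IH[of ?s] Cons.prems(5) by metis
    then show ?thesis using Cons.prems(1)[of s1] by simp
  qed
qed

text \<open>The witness is the monomial whose comparison with \<open>b\<close> removes
  \<open>x\<close>; the case \<open>a = b\<close> accounts for self-overlaps.\<close>

lemma process_list_right_blocked:
  assumes "descending us" "b \<in> set us" "x \<in> snd s b" "x \<notin> snd (process_list us s) b"
  shows "\<exists>a\<in>set us. (a = b \<or> degrevlex_less b a) \<and>
           right_blocked a (fst (process_list us s) a) b x"
  using assms
proof (induction us arbitrary: s)
  case Nil
  then show ?case by simp
next
  case (Cons a us)
  note d = descending_distinct[OF Cons.prems(1)]
  let ?s = "fold (process_pair a) (a # us) s"
  show ?case
  proof (cases "x \<in> snd ?s b")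
    case True
    then have "b \<in> set us"
      using Cons.prems(2,4) d agree_at_process_list[of b us ?s] by (auto simp: agree_at_def)
    then show ?thesis using Cons.IH[of ?s] Cons.prems True by auto
  next
    case False
    obtain s1 where s1: "agree_at b s s1" "fst s1 a = fst s a"
        "agree_at b (process_pair a b s1) ?s"
      using fold_process_pair_at[OF d Cons.prems(2)] by metis
    have ord: "a = b \<or> degrevlex_less b a" using Cons.prems(1,2) by auto
    then have "length b \<le> length a" using degrevlex_less_length by auto
    then have "right_blocked a (fst s1 a) b x"
      by (rule process_pair_right_blocked) (use False s1 Cons.prems(3) in \<open>simp_all add: agree_at_def\<close>)
    moreover have "fst s1 a = fst (process_list (a # us) s) a"
      using process_list_head_left[of a us s] d s1(2) by simp
    ultimately show ?thesis using ord by (metis list.set_intros(1))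
  qed
qed

section \<open>Multiplicative variables and prolongation steps of the division\<close>

context
  fixes n :: nat and U :: "monomial set"
  assumes fin: "finite U"
begin

abbreviation (input) "W \<equiv> left_overlap_division n"

lemma descending_listing:
  "set (descending_listing U) = U" "descending (descending_listing U)"
  using theI'[OF descending_listing_unique[OF fin]] unfolding descending_listing_def by blast+

lemma left_overlap_mult_eq:
  "left_mult W u U = fst (process_list (descending_listing U) (\<lambda>_. {1..n}, \<lambda>_. {1..n})) u"
  "right_mult W u U = snd (process_list (descending_listing U) (\<lambda>_. {1..n}, \<lambda>_. {1..n})) u"
  by (simp_all add: left_mult_def right_mult_def left_overlap_division_def process_all_eq Let_def)

lemma left_overlap_pair:
  assumes "a \<in> U" "b \<in> U" "degrevlex_less b a"
  obtains s where "fst s a = left_mult W a U"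
    "left_mult W b U \<subseteq> fst (process_pair a b s) b"
    "right_mult W b U \<subseteq> snd (process_pair a b s) b"
  using process_list_pair[OF descending_listing(2), of a b] descending_listing(1) assms
  unfolding left_overlap_mult_eq by metis

text \<open>This is rule (1) at an occurrence of \<open>b\<close> that is not a suffix.\<close>

lemma left_overlap_right_nonmult_subword:
  assumes "v @ b @ x # q \<in> U" "b \<in> U"
  shows "x \<notin> right_mult W b U"
proof -
  let ?a = "v @ b @ x # q"
  have "length b < length ?a" by simp
  then have less: "degrevlex_less b ?a" and ne: "?a \<noteq> b" unfolding degrevlex_less_def by (blast, force)
  obtain s where "fst s ?a = left_mult W ?a U"
      "left_mult W b U \<subseteq> fst (process_pair ?a b s) b"
      "right_mult W b U \<subseteq> snd (process_pair ?a b s) b"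
    by (rule left_overlap_pair[OF assms less])
  then show ?thesis using process_pair_subword(1)[OF refl ne, of s] by auto
qed

text \<open>Together with the preceding lemma: no element of \<open>U\<close> has a different
  element of \<open>U\<close> as an involutive divisor.\<close>

lemma left_overlap_left_nonmult_suffix:
  assumes "v @ b \<in> U" "b \<in> U" "v \<noteq> []"
  shows "last v \<notin> left_mult W b U"
proof -
  have less: "degrevlex_less b (v @ b)" and ne: "v @ b \<noteq> b"
    using assms(3) by (simp_all add: degrevlex_less_def)
  obtain s where "fst s (v @ b) = left_mult W (v @ b) U"
      "left_mult W b U \<subseteq> fst (process_pair (v @ b) b s) b"
      "right_mult W b U \<subseteq> snd (process_pair (v @ b) b s) b"
    by (rule left_overlap_pair[OF assms(1,2) less])
  then show ?thesis using process_pair_subword(2)[of "v @ b" v b "[]" s] ne by auto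
qed

text \<open>A monomial \<open>a\<close> that blocks \<open>x\<close> for \<open>v @ u\<close> would
  block it for \<open>u\<close> as well: a subword \<open>v @ u\<close> contains \<open>u\<close>,
  and an overlap with \<open>v @ u\<close> yields either an occurrence of \<open>u\<close> before
  \<open>x\<close> or an overlap with \<open>u\<close>.\<close>

lemma left_overlap_right_mult_extend:
  assumes "v @ u \<in> U" "u \<in> U" "x \<in> {1..n}" "x \<in> right_mult W u U"
  shows "x \<in> right_mult W (v @ u) U"
proof (cases "v = []")
  case False
  show ?thesis
  proof (rule ccontr)
    assume "x \<notin> right_mult W (v @ u) U"
    then obtain a where a: "a \<in> U" "a = v @ u \<or> degrevlex_less (v @ u) a"
      and blocked: "right_blocked a (left_mult W a U) (v @ u) x"
      using process_list_right_blocked[OF descending_listing(2), of "v @ u" x "(\<lambda>_. {1..n}, \<lambda>_. {1..n})"]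
        descending_listing(1) assms(1,3)
      unfolding left_overlap_mult_eq by auto
    have "degrevlex_less u (v @ u)" using False by (simp add: degrevlex_less_def)
    \<comment> \<open>Strictness ensures that \<open>a\<close> differs from \<open>u\<close> and is
      compared with it, even when \<open>a\<close> is \<open>v @ u\<close> itself.\<close>
    then have less: "degrevlex_less u a" using a(2) degrevlex_less_trans by auto
    from blocked show False unfolding right_blocked_def
    proof (elim disjE exE conjE)
      fix v' q assume "a = v' @ (v @ u) @ x # q"
      then show False
        using left_overlap_right_nonmult_subword[of "v' @ v" u x q] a(1) assms by simp
    next
      fix p q o' y
      assume ap: "a = p @ x # q" and vu: "v @ u = o' @ y # p"
        and p: "p \<noteq> []" and y: "y \<in> left_mult W a U"
      \<comment> \<open>Either the overlap \<open>p\<close> contains all of \<open>u\<close>, or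
        \<open>y # p\<close> lies within \<open>u\<close>.\<close>
      from vu consider z where "p = z @ u" | z where "u = z @ y # p"
        by (auto simp: append_eq_append_conv2 append_eq_Cons_conv)
      then show False
      proof cases
        case 1
        then show False
          using left_overlap_right_nonmult_subword[of z u x q] a(1) ap assms by simp
      next
        case 2
        obtain s where "fst s a = left_mult W a U" "right_mult W u U \<subseteq> snd (process_pair a u s) u"
          using left_overlap_pair[OF a(1) assms(2) less] by metis
        then show False
          using process_pair_overlap[OF ap 2 p, of s] y assms(4) less degrevlex_less_irrefl by auto
      qed
    qed
  qed
qed (use assms in simp)

text \<open>A divisor missing the appended letter would divide \<open>u\<close> involutively, hence
  equal \<open>u\<close>; but the appended letter is nonmultiplicative for \<open>u\<close>.\<close>

lemma right_prolongation_step_left_overlap: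
  assumes "right_prolongation_step W U l u r l' u' r'" "u \<in> U"
  shows "r \<noteq> [] \<and> hd r \<notin> right_mult W u U \<and> r' = tl r"
proof -
  obtain v1 v2 where r: "r \<noteq> []" "hd r \<notin> right_mult W u U"
    and inv: "involutive_divisor_at W U u' (u @ [hd r]) v1 v2" and r': "r' = v2 @ tl r"
    using assms(1) unfolding right_prolongation_step_def by blast
  have u': "u' \<in> U" and eq: "u @ [hd r] = v1 @ u' @ v2"
    and left: "v1 \<noteq> [] \<Longrightarrow> last v1 \<in> left_mult W u' U"
    and right: "v2 \<noteq> [] \<Longrightarrow> hd v2 \<in> right_mult W u' U"
    using inv unfolding involutive_divisor_at_def by auto
  have "v2 = []"
  proof (rule ccontr)
    assume "v2 \<noteq> []"
    then obtain v x where v2: "v2 = v @ [x]" by (metis rev_exhaust)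
    with eq have u: "u = v1 @ u' @ v" "hd r = x" by simp_all
    show False
    proof (cases v)
      case Nil
      then show False
        using u v2 r(2) left right left_overlap_left_nonmult_suffix[of v1 u'] assms(2) u'
        by (cases "v1 = []") auto
    next
      case (Cons y ys)
      then show False
        using u v2 right left_overlap_right_nonmult_subword[of v1 u' y ys] assms(2) u' by auto
    qed
  qed
  then show ?thesis using r r' by simp
qed

text \<open>As before, the divisor must contain the new letter. It may however stop before the end
  of \<open>u\<close>, since rule (1) does not forbid a proper prefix of \<open>last l # u\<close>,
  which need not lie in \<open>U\<close>; \<open>v\<close> is what it leaves over.\<close>

lemma left_prolongation_step_left_overlap:
  assumes "left_prolongation_step W U l u r l' u' r'" "u \<in> U"
  obtains v where "l \<noteq> []" "l' = butlast l" "r' = v @ r" "last l # u = u' @ v"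
    "v \<noteq> [] \<Longrightarrow> hd v \<in> right_mult W u' U"
proof -
  obtain v1 v2 where l: "l \<noteq> []" "last l \<notin> left_mult W u U"
    and inv: "involutive_divisor_at W U u' (last l # u) v1 v2"
    and l': "l' = butlast l @ v1" and r': "r' = v2 @ r"
    using assms(1) unfolding left_prolongation_step_def by blast
  have u': "u' \<in> U" and eq: "last l # u = v1 @ u' @ v2"
    and left: "v1 \<noteq> [] \<Longrightarrow> last v1 \<in> left_mult W u' U"
    and right: "v2 \<noteq> [] \<Longrightarrow> hd v2 \<in> right_mult W u' U"
    using inv unfolding involutive_divisor_at_def by auto
  have "v1 = []"
  proof (rule ccontr)
    assume "v1 \<noteq> []"
    then obtain v where v1: "v1 = last l # v" and u: "u = v @ u' @ v2"
      using eq by (auto simp: Cons_eq_append_conv)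
    show False
    proof (cases v2)
      case Nil
      then show False
        using u v1 l(2) left left_overlap_left_nonmult_suffix[of v u'] assms(2) u'
        by (cases "v = []") auto
    next
      case (Cons y ys)
      then show False
        using u right left_overlap_right_nonmult_subword[of v u' y ys] assms(2) u' by auto
    qed
  qed
  then show ?thesis using that[of v2] l l' r' eq right by simp
qed

end

section \<open>Exclusion of cycles\<close>

theorem proposition5p5p31:
  fixes n :: nat
  shows "continuous_division n (left_overlap_division n)"
  unfolding continuous_division_def
proof (intro allI impI, elim conjE)
  fix w U k and u l r :: "nat \<Rightarrow> monomial"
  let ?W = "left_overlap_division n"
  assume w: "w \<in> monomials n" and fin: "finite U"
    and occ: "\<forall>i\<in>{1..k}. u i \<in> U \<and> w = l i @ u i @ r i"
    and steps: "\<forall>i\<in>{1..<k}.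
      left_prolongation_step ?W U (l i) (u i) (r i) (l (i + 1)) (u (i + 1)) (r (i + 1)) \<noteq>
      right_prolongation_step ?W U (l i) (u i) (r i) (l (i + 1)) (u (i + 1)) (r (i + 1))"
  define Q where "Q i \<longleftrightarrow> r i \<noteq> [] \<and> hd (r i) \<in> right_mult ?W (u i) U" for i
  \<comment> \<open>Encodes the lexicographic order, as \<open>length (l i)\<close> is at most
    \<open>length w\<close>.\<close>
  define d where "d i = length (r i) * Suc (length w) + length (l i)" for i
  have prolong: "(Q i \<longrightarrow> Q (Suc i) \<and> length (l (Suc i)) < length (l i)) \<and>
      (Q (Suc i) \<or> d (Suc i) < d i)" if i: "1 \<le> i" "i < k" for i
  proof -
    have occ_i: "u i \<in> U" "w = l i @ u i @ r i" and occ_Suc: "u (Suc i) \<in> U"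
        "w = l (Suc i) @ u (Suc i) @ r (Suc i)"
      using occ i by auto
    from steps i consider
        (left) "left_prolongation_step ?W U (l i) (u i) (r i) (l (Suc i)) (u (Suc i)) (r (Suc i))"
      | (right) "right_prolongation_step ?W U (l i) (u i) (r i) (l (Suc i)) (u (Suc i)) (r (Suc i))"
      by fastforce
    then show ?thesis
    proof cases
      case left
      obtain v where v: "l i \<noteq> []" "l (Suc i) = butlast (l i)" "r (Suc i) = v @ r i"
          "last (l i) # u i = u (Suc i) @ v" "v \<noteq> [] \<Longrightarrow> hd v \<in> right_mult ?W (u (Suc i)) U"
        using left_prolongation_step_left_overlap[OF fin left occ_i(1)] by metis
      have less: "length (l (Suc i)) < length (l i)" using v(1,2) by simp
      \<comment> \<open>For \<open>v = []\<close> the right end stays and \<open>Q\<close> is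
        inherited; otherwise \<open>hd v\<close> follows the new occurrence and gives
        \<open>Q\<close> at once.\<close>
      show ?thesis
      proof (cases "v = []")
        case True
        have "Q (Suc i)" if "Q i"
        proof -
          \<comment> \<open>Only the variables with index in \<open>{1..n}\<close> start out as
            multiplicative.\<close>
          have "hd (r i) \<in> set w" using that occ_i(2) by (simp add: Q_def)
          then have "hd (r i) \<in> {1..n}" using w by (auto simp: monomials_def)
          then show ?thesis
            using left_overlap_right_mult_extend[OF fin, of "[last (l i)]" "u i" "hd (r i)" n]
              that v(3,4) True occ_i(1) occ_Suc(1) by (simp add: Q_def)
        qed
        then show ?thesis using less v(3) True by (simp add: d_def)
      next
        case False
        then show ?thesis using less v(3,5) by (simp add: Q_def)
      qed
    next
      case right
      have R: "r i \<noteq> []" "\<not> Q i" "r (Suc i) = tl (r i)"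
        using right_prolongation_step_left_overlap[OF fin right occ_i(1)] by (simp_all add: Q_def)
      \<comment> \<open>The left end may move right, but the loss of one letter of
        \<open>r i\<close> outweighs this.\<close>
      have "length (l (Suc i)) \<le> length w" unfolding occ_Suc(2) by simp
      then have "d (Suc i) < d i" using R(1,3) by (cases "r i") (auto simp: d_def)
      then show ?thesis using R(2) by simp
    qed
  qed
  have neq: "(l i, r i) \<noteq> (l j, r j)" if ij: "1 \<le> i" "i < j" "j \<le> k" for i j
  proof
    assume eq: "(l i, r i) = (l j, r j)"
    have "w = l i @ u i @ r i" "w = l j @ u j @ r j" using occ ij by auto
    \<comment> \<open>The cofactors determine the middle factor of \<open>w\<close>, so
      \<open>Q\<close> agrees at both ends of the cycle.\<close>
    with eq have "u i = u j" by auto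
    with eq have Qij: "Q i \<longleftrightarrow> Q j" by (simp add: Q_def)
    have Q_dec: "Q m \<and> length (l m) < length (l i)" if "Q i" "Suc i \<le> m" "m \<le> j" for m
      using that(2,3)
    proof (induction m rule: dec_induct)
      case base
      then show ?case using prolong[of i] ij \<open>Q i\<close> by simp
    next
      case (step m)
      then show ?case using prolong[of m] ij by auto
    qed
    have d_dec: "Q m \<or> d m < d i" if "Suc i \<le> m" "m \<le> j" for m
      using that
    proof (induction m rule: dec_induct)
      case base
      then show ?case using prolong[of i] ij by simp
    next
      case (step m)
      then show ?case using prolong[of m] ij by auto
    qed
    \<comment> \<open>With \<open>Q i\<close> the left cofactor has become strictly shorter; without
      it \<open>Q j\<close> fails too, so \<open>d\<close> has strictly decreased.\<close>
    show False
    proof (cases "Q i")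
      case True
      then show False using Q_dec[of j] eq ij by simp
    next
      case False
      then show False using d_dec[of j] Qij eq ij by (simp add: d_def)
    qed
  qed
  show "\<forall>i\<in>{1..k}. \<forall>j\<in>{1..k}. i \<noteq> j \<longrightarrow> (l i, r i) \<noteq> (l j, r j)"
  proof (intro ballI impI)
    fix i j assume "i \<in> {1..k}" "j \<in> {1..k}" "i \<noteq> j"
    then show "(l i, r i) \<noteq> (l j, r j)" using neq[of i j] neq[of j i]
      by (cases i j rule: linorder_cases) auto
  qed
qed

end
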